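(* Let $n\geq 1$ and let $T$ be a formal-dual subset of $\mathbb{Z}/n\mathbb{Z}$. Then the weight enumerator of $T$ satisfies $$\nu_T(y)=\nu_T(\gcd(y,n))$$ for all $y\in\mathbb{Z}/n\mathbb{Z}$.
   Context: Let $\zeta_n = e^{2\pi i/n}$. For $S\subset\mathbb{Z}/n\mathbb{Z}$, the weight enumerator of $S$ is $\nu_S\colon \mathbb{Z}/n\mathbb{Z}\to\mathbb{N}_0$, $\nu_S(y)=\#\{(v,w)\in S\times S : v-w=y\}$. Two nonempty subsets $S,T\subset \mathbb{Z}/n\mathbb{Z}$ are formally-dual to each other if $\frac{|S|^2}{|T|}\nu_T(y)=\sum_{v\in\mathbb{Z}/n\mathbb{Z}}\nu_S(v)\zeta_n^{vy}$ for every $y\in\mathbb{Z}/n\mathbb{Z}$ (this relation is symmetric in $S$ and $T$). A set $T\subset\mathbb{Z}/n\mathbb{Z}$ is formal-dual if there is an $S\subset\mathbb{Z}/n\mathbb{Z}$ such that $S$ and $T$ are formally-dual to each other. For $y\in\mathbb{Z}/n\mathbb{Z}$, $\gcd(y,n)$ denotes the greatest common divisor of $n$ with any integer representative of $y$ (independent of the choice; $\gcd(0,n)=n$); in $\nu_T(\gcd(y,n))$ this integer is read modulo $n$. *)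

theory Defs
  imports Complex_Main "HOL-Number_Theory.Cong"
begin

text \<open>
  The elements of \<open>\<int>/n\<int>\<close> are represented by their least nonnegative integer representatives.
  The library's \<open>residue_ring\<close> is not used because it is not a ring for \<open>n = 1\<close>:
  its \<open>\<one>\<close> is then not in its carrier.
\<close>

definition Zmod :: "nat \<Rightarrow> int set" where
  "Zmod n = {0..<int n}"

definition zeta :: "nat \<Rightarrow> complex" where
  "zeta n = exp (2 * of_real pi * \<i> / of_nat n)"

text \<open>
  The equation \<open>v - w = y\<close> is read in \<open>\<int>/n\<int>\<close>. The argument \<open>y\<close> may be any
  integer representative, so \<open>y = n\<close> denotes the zero class.
\<close>

definition weight_enumerator :: "nat \<Rightarrow> int set \<Rightarrow> int \<Rightarrow> nat" where
  "weight_enumerator n S y = card {(v, w) \<in> S \<times> S. [v - w = y] (mod int n)}"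

lemma weight_enumerator_cong:
  assumes "[y = z] (mod int n)"
  shows "weight_enumerator n S y = weight_enumerator n S z"
  using assms unfolding weight_enumerator_def cong_def by simp

definition formally_dual :: "nat \<Rightarrow> int set \<Rightarrow> int set \<Rightarrow> bool" where
  "formally_dual n S T \<longleftrightarrow>
     S \<subseteq> Zmod n \<and> S \<noteq> {} \<and> T \<subseteq> Zmod n \<and> T \<noteq> {} \<and>
     (\<forall>y\<in>Zmod n.
        (of_nat (card S))\<^sup>2 / of_nat (card T) * of_nat (weight_enumerator n T y) =
        (\<Sum>v\<in>Zmod n. of_nat (weight_enumerator n S v) * zeta n powi (v * y)))"

definition formal_dual :: "nat \<Rightarrow> int set \<Rightarrow> bool" where
  "formal_dual n T \<longleftrightarrow> (\<exists>S. formally_dual n S T)"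

end

theory Submission
  imports Defs "HOL-Number_Theory.Residues" "HOL-Computational_Algebra.Polynomial"
begin

text \<open>
  The numbers \<open>A y = |S|\<^sup>2 \<nu>\<^sub>T y\<close> are values \<open>F (\<zeta>\<^sup>y)\<close> of an integer polynomial
  \<open>F\<close> at roots of unity. Instead of the Galois action on \<open>\<zeta>\<close>, i.e. the irreducibility of the
  cyclotomic polynomial, use Frobenius: for a prime \<open>p\<close>, \<open>F\<^sup>p\<close> and \<open>F (X\<^sup>p)\<close> agree modulo \<open>p\<close>, which
  gives \<open>A (p y) \<equiv> A y\<close> modulo \<open>p\<close>. As \<open>A\<close> is bounded, this is an equality for all large \<open>p\<close>.
  Finally, \<open>y\<close> is congruent modulo \<open>n\<close> to \<open>u gcd y n\<close> for some \<open>u\<close> all of whose prime factors are large.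
\<close>

section \<open>Frobenius and Fermat congruences\<close>

lemma freshmans_dream_dvd:
  fixes x y :: "'a :: comm_ring_1"
  assumes "prime p"
  shows "of_nat p dvd (x + y) ^ p - (x ^ p + y ^ p)"
proof -
  have p: "p > 0" using assms prime_gt_0_nat by blast
  have "{..p} = insert 0 (insert p {0<..<p})" using p by auto
  hence "(x + y) ^ p = x ^ p + y ^ p + (\<Sum>k\<in>{0<..<p}. of_nat (p choose k) * x ^ k * y ^ (p - k))"
    using p by (subst binomial_ring) (simp add: algebra_simps)
  moreover have "of_nat p dvd (\<Sum>k\<in>{0<..<p}. of_nat (p choose k) * x ^ k * y ^ (p - k))"
  proof (rule dvd_sum)
    fix k assume "k \<in> {0<..<p}"
    hence "p dvd (p choose k)" using assms by (intro dvd_choose_prime) auto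
    hence "(of_nat p :: 'a) dvd of_nat (p choose k)" by (metis dvd_def of_nat_mult)
    thus "of_nat p dvd of_nat (p choose k) * x ^ k * y ^ (p - k)" by simp
  qed
  ultimately show ?thesis by simp
qed

text \<open>A divisibility rather than an equation in characteristic \<open>p\<close>: the
  application is to \<open>int poly\<close>, where the \<open>p\<close>-th power map is additive
  only modulo \<open>p\<close>.\<close>

lemma freshmans_dream_sum_dvd:
  fixes f :: "'b \<Rightarrow> 'a :: comm_ring_1"
  assumes "prime p"
  shows "of_nat p dvd (\<Sum>i\<in>I. f i) ^ p - (\<Sum>i\<in>I. f i ^ p)"
proof (induction I rule: infinite_finite_induct)
  case (insert i I)
  have "of_nat p dvd (f i + sum f I) ^ p - (f i ^ p + sum f I ^ p) + (sum f I ^ p - (\<Sum>i\<in>I. f i ^ p))"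
    using freshmans_dream_dvd[OF assms] insert.IH by (rule dvd_add)
  with insert.hyps show ?case by (simp add: algebra_simps)
qed (use assms prime_gt_0_nat in \<open>auto simp: power_0_left\<close>)

lemma fermat_int:
  fixes a :: int
  assumes "prime p" "\<not> int p dvd a"
  shows "[a ^ (p - 1) = 1] (mod int p)"
proof -
  have p: "int p > 0" using assms(1) prime_gt_0_nat by auto
  define b where "b = nat (a mod int p)"
  have b: "[a = int b] (mod int p)" using p by (simp add: b_def cong_def)
  hence "\<not> p dvd b" using assms(2) by (metis cong_dvd_iff of_nat_dvd_iff cong_sym)
  hence "[b ^ (p - 1) = 1] (mod p)" using assms(1) fermat_theorem by blast
  hence "[int b ^ (p - 1) = 1] (mod int p)" by (metis cong_int_iff of_nat_1 of_nat_power)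
  thus ?thesis using cong_pow[OF b] cong_trans by blast
qed

lemma fermat_int_dvd:
  fixes a :: int
  assumes "prime p"
  shows "int p dvd a ^ p - a"
proof (cases "int p dvd a")
  case True
  have "int p dvd a ^ p" using True dvd_power[of p a] prime_gt_0_nat[OF assms] dvd_trans by blast
  thus ?thesis using True by (rule dvd_diff)
next
  case False
  have "int p dvd a ^ (p - 1) - 1"
    using fermat_int[OF assms False] by (simp add: cong_iff_dvd_diff)
  hence "int p dvd a * (a ^ (p - 1) - 1)" by simp
  also have "a * (a ^ (p - 1) - 1) = a ^ p - a"
    using assms prime_gt_0_nat by (simp add: algebra_simps power_eq_if)
  finally show ?thesis .
qed

section \<open>Integer polynomials at roots of unity\<close>

abbreviation int_poly_eval :: "int poly \<Rightarrow> complex \<Rightarrow> complex" where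
  "int_poly_eval F x \<equiv> poly (map_poly of_int F) x"

lemma int_poly_eval_add: "int_poly_eval (F + G) x = int_poly_eval F x + int_poly_eval G x"
proof -
  have "map_poly of_int (F + G) = (map_poly of_int F + map_poly of_int G :: complex poly)"
    by (intro poly_eqI) (simp add: coeff_map_poly)
  thus ?thesis by simp
qed

lemma int_poly_eval_diff: "int_poly_eval (F - G) x = int_poly_eval F x - int_poly_eval G x"
  using int_poly_eval_add[of "F - G" G x] by simp

lemma int_poly_eval_mult: "int_poly_eval (F * G) x = int_poly_eval F x * int_poly_eval G x"
proof -
  have "map_poly of_int (F * G) = (map_poly of_int F * map_poly of_int G :: complex poly)"
    by (intro poly_eqI) (simp add: coeff_map_poly coeff_mult)
  thus ?thesis by simp
qed

lemma int_poly_eval_power: "int_poly_eval (F ^ k) x = int_poly_eval F x ^ k"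
  by (induction k) (simp_all add: int_poly_eval_mult map_poly_1)

lemma int_poly_eval_sum: "int_poly_eval (\<Sum>i\<in>I. F i) x = (\<Sum>i\<in>I. int_poly_eval (F i) x)"
  by (induction I rule: infinite_finite_induct) (simp_all add: int_poly_eval_add)

lemma int_poly_eval_monom: "int_poly_eval (monom c k) x = of_int c * x ^ k"
  by (simp add: map_poly_monom poly_monom)

lemma int_poly_eval_of_nat: "int_poly_eval (of_nat m) x = of_nat m"
  by (simp add: of_nat_poly map_poly_pCons)

lemma power_mult_mod:
  fixes z :: "'a :: comm_monoid_mult"
  assumes "z ^ n = 1"
  shows "z ^ (k * (y mod n)) = z ^ (k * y)"
proof -
  have "z ^ (k * y) = z ^ (n * (k * (y div n)) + k * (y mod n))"
    by (metis distrib_left mult.left_commute mult_div_mod_eq)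
  also have "\<dots> = (z ^ n) ^ (k * (y div n)) * z ^ (k * (y mod n))"
    by (simp only: power_add power_mult)
  finally show ?thesis using assms by simp
qed

text \<open>Expanding \<open>F\<close> leaves an integer combination of the power sums of the
  \<open>z ^ y\<close>. Each power sum is \<open>n\<close> or, by the geometric series,
  \<open>0\<close>.\<close>

lemma sum_int_poly_eval_Ints:
  assumes "z ^ n = 1"
  shows "(\<Sum>y<n. int_poly_eval F (z ^ y)) \<in> \<int>"
proof -
  have power_sum: "(\<Sum>y<n. (z ^ y) ^ i) \<in> \<int>" for i
  proof (cases "z ^ i = 1")
    case True
    hence "(z ^ y) ^ i = 1" for y by (metis mult.commute power_mult power_one)
    thus ?thesis by simp
  next
    case False
    have "(\<Sum>y<n. (z ^ y) ^ i) = (\<Sum>y<n. (z ^ i) ^ y)"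
      by (simp add: mult.commute flip: power_mult)
    also have "\<dots> = ((z ^ i) ^ n - 1) / (z ^ i - 1)"
      using False by (rule geometric_sum)
    also have "(z ^ i) ^ n = 1"
      using assms by (metis mult.commute power_mult power_one)
    finally show ?thesis by simp
  qed
  define P where "P = (map_poly of_int F :: complex poly)"
  have "(\<Sum>y<n. poly P (z ^ y)) = (\<Sum>i\<le>degree P. coeff P i * (\<Sum>y<n. (z ^ y) ^ i))"
    by (simp add: poly_altdef sum_distrib_left) (rule sum.swap)
  also have "\<dots> \<in> \<int>"
    by (intro Ints_sum Ints_mult power_sum) (simp add: P_def coeff_map_poly)
  finally show ?thesis by (simp add: P_def)
qed

text \<open>
  Detects divisibility by \<open>p\<close> without knowing that rational algebraic integers are integers: modulo
  \<open>p\<close>, the sum counts the terms that are prime to \<open>p\<close>.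
\<close>
lemma dvd_of_dvd_sum_power:
  fixes D :: "'a \<Rightarrow> int"
  assumes "prime p" "finite I" "card I < p" "int p dvd (\<Sum>i\<in>I. D i ^ (p - 1))" "i \<in> I"
  shows "int p dvd D i"
proof -
  define J where "J = {i \<in> I. \<not> int p dvd D i}"
  have "[D i ^ (p - 1) = of_bool (\<not> int p dvd D i)] (mod int p)" for i
  proof (cases "int p dvd D i")
    case True
    have "p - 1 > 0" using assms(1) prime_gt_1_nat by auto
    hence "int p dvd D i ^ (p - 1)" using True dvd_power[of "p - 1" "D i"] dvd_trans by blast
    thus ?thesis using True by (simp add: cong_0_iff)
  next
    case False
    thus ?thesis using fermat_int[OF assms(1) False] by simp
  qed
  hence "[(\<Sum>i\<in>I. D i ^ (p - 1)) = (\<Sum>i\<in>I. of_bool (\<not> int p dvd D i))] (mod int p)"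
    by (intro cong_sum)
  moreover have "(\<Sum>i\<in>I. of_bool (\<not> int p dvd D i)) = int (card J)"
    using assms(2) by (simp add: J_def Int_def)
  ultimately have "p dvd card J"
    using assms(4) by (metis cong_dvd_iff of_nat_dvd_iff cong_sym)
  \<comment> \<open>Since \<open>card I < p\<close>, a count divisible by \<open>p\<close> must
    vanish.\<close>
  moreover have "card J \<le> card I" using assms(2) by (intro card_mono) (auto simp: J_def)
  ultimately have "card J = 0" using assms(3) by (auto dest: dvd_imp_le)
  hence "J = {}" using assms(2) by (simp add: J_def)
  thus ?thesis using assms(5) by (auto simp: J_def)
qed

text \<open>With \<open>F\<close> and \<open>H\<close> below, \<open>A y\<close> and
  \<open>A (p * y)\<close> are the values of \<open>F\<close> and \<open>H\<close> at
  \<open>z ^ y\<close>, and \<open>F ^ p - H = p * G\<close>. The value of \<open>G\<close> at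
  \<open>z ^ y\<close> need not be visibly an integer, so divisibility of \<open>D y\<close> by
  \<open>p\<close> is drawn from the sum of the powers \<open>D y ^ (p - 1)\<close> over a full
  period.\<close>

lemma dvd_diff_integer_fourier_transform:
  fixes A c :: "nat \<Rightarrow> int" and z :: complex
  assumes A: "\<And>y. of_int (A y) = (\<Sum>v<n. of_int (c v) * z ^ (v * y))"
    and z: "z ^ n = 1" and n: "n > 0" and p: "prime p" "p > n"
  shows "int p dvd A (p * y) - A y"
proof -
  define F where "F = (\<Sum>v<n. monom (c v) v)"
  define H where "H = (\<Sum>v<n. monom (c v) (v * p))"
  define D where "D y = A y ^ p - A (p * y)" for y
  have "of_nat p dvd F ^ p - (\<Sum>v<n. monom (c v) v ^ p)"
    unfolding F_def by (rule freshmans_dream_sum_dvd[OF p(1)])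
  moreover have "of_nat p dvd (\<Sum>v<n. monom (c v) v ^ p - monom (c v) (v * p))"
  proof (rule dvd_sum)
    fix v
    \<comment> \<open>The \<open>p\<close>-th power also raises the coefficient \<open>c v\<close>
      to the power \<open>p\<close>; Fermat restores it modulo \<open>p\<close>.\<close>
    obtain k where "c v ^ p - c v = int p * k"
      using fermat_int_dvd[OF p(1)] by blast
    hence "monom (c v) v ^ p - monom (c v) (v * p) = of_nat p * monom k (v * p)"
      by (simp add: monom_power diff_monom of_nat_poly smult_monom mult.commute)
    thus "of_nat p dvd monom (c v) v ^ p - monom (c v) (v * p)" by simp
  qed
  ultimately have "of_nat p dvd F ^ p - (\<Sum>v<n. monom (c v) v ^ p)
      + (\<Sum>v<n. monom (c v) v ^ p - monom (c v) (v * p))"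
    by (rule dvd_add)
  hence "of_nat p dvd F ^ p - H" by (simp add: H_def sum_subtractf)
  then obtain G where G: "F ^ p - H = of_nat p * G" by blast
  have F_eval: "int_poly_eval F (z ^ y) = of_int (A y)" for y
    by (simp add: F_def A int_poly_eval_sum int_poly_eval_monom mult.commute flip: power_mult)
  have H_eval: "int_poly_eval H (z ^ y) = of_int (A (p * y))" for y
    by (simp add: H_def A int_poly_eval_sum int_poly_eval_monom mult_ac flip: power_mult)
  have D_eval: "of_int (D y) = of_nat p * int_poly_eval G (z ^ y)" for y
    using arg_cong[OF G, of "\<lambda>Q. int_poly_eval Q (z ^ y)"]
    by (simp add: D_def int_poly_eval_diff int_poly_eval_power int_poly_eval_mult
        int_poly_eval_of_nat F_eval H_eval)
  \<comment> \<open>Single values of \<open>G ^ (p - 1)\<close> may be irrational; their sum over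
    \<open>y < n\<close> is an integer.\<close>
  obtain m where m: "(\<Sum>y<n. int_poly_eval (G ^ (p - 1)) (z ^ y)) = of_int m"
    using Ints_cases[OF sum_int_poly_eval_Ints[OF z, of "G ^ (p - 1)"]] by blast
  have "of_int (\<Sum>y<n. D y ^ (p - 1)) = (of_int (int p ^ (p - 1) * m) :: complex)"
    by (simp add: D_eval power_mult_distrib int_poly_eval_power sum_distrib_left flip: m)
  hence "(\<Sum>y<n. D y ^ (p - 1)) = int p ^ (p - 1) * m" by (simp only: of_int_eq_iff)
  moreover have "p - 1 > 0" using p(1) prime_gt_1_nat by auto
  ultimately have "int p dvd (\<Sum>y<n. D y ^ (p - 1))" by (simp add: dvd_power)
  note D_dvd = dvd_of_dvd_sum_power[OF p(1) finite_lessThan _ this]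
  \<comment> \<open>\<open>D_dvd\<close> covers only \<open>y < n\<close>; periodicity of
    \<open>A\<close> modulo \<open>n\<close> extends it to every \<open>y\<close>.\<close>
  note periodic = power_mult_mod[OF z]
  have "(of_int (A (y mod n)) :: complex) = of_int (A y)"
    unfolding A periodic ..
  moreover have "(of_int (A (p * (y mod n))) :: complex) = of_int (A (p * y))"
    unfolding A mult.assoc[symmetric] periodic ..
  ultimately have "D (y mod n) = D y" by (simp add: D_def)
  hence "int p dvd A y ^ p - A (p * y)" using D_dvd[of "y mod n"] n p(2) by (simp add: D_def)
  with fermat_int_dvd[OF p(1)] have "int p dvd (A y ^ p - A y) - (A y ^ p - A (p * y))"
    by (rule dvd_diff)
  thus ?thesis by simp
qed

section \<open>Multipliers with only large prime factors\<close>

lemma mult_invariant_of_prime_divisors: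
  fixes u :: nat
  assumes "u > 0" "\<And>p y. prime p \<Longrightarrow> p dvd u \<Longrightarrow> w (p * y) = w y"
  shows "w (u * y) = w y"
  using assms
proof (induction u arbitrary: y rule: prime_divisors_induct)
  case (factor p x)
  have "w (p * x * y) = w (x * y)" using factor.prems factor.hyps by (simp add: mult.assoc)
  also have "\<dots> = w y" using factor.prems by (intro factor.IH) auto
  finally show ?case .
qed auto

text \<open>
  The factor \<open>u\<close> is \<open>a + m t\<close>, where \<open>t\<close> is the product of the primes up to \<open>B\<close> that do not divide
  \<open>a\<close>: a prime up to \<open>B\<close> divides exactly one of \<open>a\<close> and \<open>m t\<close>, hence not their sum.
  This avoids Dirichlet's theorem.
\<close>
lemma exists_cong_large_prime_factors:
  fixes a m B :: nat
  assumes "coprime a m" "m > 0"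
  obtains u where "u > 0" "[u = a] (mod m)" "\<And>p. prime p \<Longrightarrow> p dvd u \<Longrightarrow> p > B"
proof
  define Q where "Q = {q. prime q \<and> q \<le> B \<and> \<not> q dvd a}"
  define t where "t = \<Prod>Q"
  have fin: "finite Q" by (rule finite_subset[of _ "{..B}"]) (auto simp: Q_def)
  have "t > 0" unfolding t_def by (rule prod_pos) (auto simp: Q_def prime_gt_0_nat)
  thus "a + m * t > 0" using assms(2) by simp
  show "[a + m * t = a] (mod m)" by (simp add: cong_def)
  fix p assume p: "prime p" "p dvd a + m * t"
  show "p > B"
  proof (rule ccontr)
    assume "\<not> p > B"
    show False
    proof (cases "p dvd a")
      case True
      hence "p dvd m * t" using p(2) by (simp add: dvd_add_right_iff)
      moreover have "\<not> p dvd m" using True assms(1) p(1) by (meson coprime_common_divisor not_prime_unit)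
      ultimately have "p dvd \<Prod>Q" using p(1) by (simp add: prime_dvd_mult_iff t_def)
      then obtain q where q: "q \<in> Q" "p dvd q" using p(1) fin by (auto simp: prime_dvd_prod_iff)
      hence "p = q" using p(1) by (intro primes_dvd_imp_eq) (auto simp: Q_def)
      with q have "p \<in> Q" by simp
      thus False using True by (simp add: Q_def)
    next
      case False
      hence "p \<in> Q" using p(1) \<open>\<not> p > B\<close> by (simp add: Q_def)
      hence "p dvd t" unfolding t_def using fin by (intro dvd_prodI)
      thus False using p(2) False by (simp add: dvd_add_left_iff)
    qed
  qed
qed

section \<open>Weight enumerators of formally dual sets\<close>

lemma weight_enumerator_le:
  assumes "finite S"
  shows "weight_enumerator n S y \<le> (card S)\<^sup>2"
proof -
  have "weight_enumerator n S y \<le> card (S \<times> S)"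
    unfolding weight_enumerator_def using assms by (intro card_mono) auto
  thus ?thesis by (simp add: card_cartesian_product power2_eq_square)
qed

lemma zeta_power_eq_1: "n > 0 \<Longrightarrow> zeta n ^ n = 1"
  by (simp add: zeta_def flip: exp_of_nat_mult)

text \<open>Multiplying the duality equation by \<open>card T\<close> clears the denominator, so
  that the values and the Fourier coefficients are integers.\<close>

lemma formally_dual_scaled_eq:
  assumes "formally_dual n S T" "n > 0"
  shows "of_nat ((card S)\<^sup>2 * weight_enumerator n T (int y)) =
    (\<Sum>v<n. of_nat (card T * weight_enumerator n S (int v)) * zeta n ^ (v * y))"
proof -
  have fin: "finite T" "T \<noteq> {}"
    using assms(1) finite_subset[of T "{0..<int n}"] by (auto simp: formally_dual_def Zmod_def)
  hence T: "(of_nat (card T) :: complex) \<noteq> 0" by simp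
  define r where "r = y mod n"
  have "int r \<in> Zmod n" using assms(2) by (simp add: r_def Zmod_def)
  hence "of_nat (card S) ^ 2 / of_nat (card T) * of_nat (weight_enumerator n T (int r)) =
      (\<Sum>v\<in>Zmod n. of_nat (weight_enumerator n S v) * zeta n powi (v * int r))"
    using assms(1) unfolding formally_dual_def by blast
  also have "\<dots> = (\<Sum>v<n. of_nat (weight_enumerator n S (int v)) * zeta n powi (int v * int r))"
    unfolding Zmod_def by (rule sum.reindex_bij_witness[of _ int nat]) auto
  also have "\<dots> = (\<Sum>v<n. of_nat (weight_enumerator n S (int v)) * zeta n ^ (v * y))"
  proof (rule sum.cong)
    fix v
    have "zeta n ^ (v * r) = zeta n ^ (v * y)"
      unfolding r_def by (rule power_mult_mod[OF zeta_power_eq_1[OF assms(2)]])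
    thus "of_nat (weight_enumerator n S (int v)) * zeta n powi (int v * int r) =
        of_nat (weight_enumerator n S (int v)) * zeta n ^ (v * y)"
      by (simp flip: of_nat_mult)
  qed simp
  finally have "of_nat (card S) ^ 2 * of_nat (weight_enumerator n T (int r)) =
      of_nat (card T) * (\<Sum>v<n. of_nat (weight_enumerator n S (int v)) * zeta n ^ (v * y))"
    using T by (simp add: field_simps)
  moreover have "weight_enumerator n T (int r) = weight_enumerator n T (int y)"
    by (rule weight_enumerator_cong) (simp add: r_def cong_def of_nat_mod)
  ultimately show ?thesis by (simp add: sum_distrib_left mult.assoc)
qed

text \<open>The bound on \<open>p\<close> has two tasks: \<open>p > n\<close> yields the congruence
  modulo \<open>p\<close>, and the product of squares keeps both scaled values below
  \<open>p\<close>, so that congruent values are equal.\<close>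

lemma weight_enumerator_mult_prime:
  assumes dual: "formally_dual n S T" and n: "n > 0"
    and p: "prime p" "p > n + (card S)\<^sup>2 * (card T)\<^sup>2"
  shows "weight_enumerator n T (int (p * y)) = weight_enumerator n T (int y)"
proof -
  define A where "A y = (card S)\<^sup>2 * weight_enumerator n T (int y)" for y
  have fin: "finite S" "S \<noteq> {}" "finite T"
    using dual finite_subset[of T "{0..<int n}"] finite_subset[of S "{0..<int n}"]
    by (auto simp: formally_dual_def Zmod_def)
  have "of_int (int (A y)) = (\<Sum>v<n. of_int (int (card T * weight_enumerator n S (int v))) * zeta n ^ (v * y))" for y
    using formally_dual_scaled_eq[OF dual n, of y] by (simp add: A_def)
  hence "int p dvd int (A (p * y)) - int (A y)"
    by (rule dvd_diff_integer_fourier_transform) (use zeta_power_eq_1[OF n] n p in auto)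
  moreover have "A y < p" for y
  proof -
    have "A y \<le> (card S)\<^sup>2 * (card T)\<^sup>2"
      unfolding A_def using weight_enumerator_le[OF fin(3)] by (intro mult_left_mono) auto
    thus ?thesis using p(2) by simp
  qed
  ultimately have "A (p * y) = A y"
    by (intro cong_less_modulus_unique_nat[of _ _ p]) (simp_all add: cong_iff_dvd_diff flip: cong_int_iff)
  thus ?thesis using fin by (simp add: A_def)
qed

theorem theorem3p1:
  fixes n :: nat and T :: "int set"
  assumes "n \<ge> 1"
    and "formal_dual n T"
  shows "\<forall>y\<in>Zmod n. weight_enumerator n T y = weight_enumerator n T (gcd y (int n))"
proof
  fix y' assume "y' \<in> Zmod n"
  define y where "y = nat y'"
  have y': "y' = int y" using \<open>y' \<in> Zmod n\<close> by (simp add: y_def Zmod_def)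
  obtain S where dual: "formally_dual n S T" using assms(2) by (auto simp: formal_dual_def)
  have n: "n > 0" using assms(1) by simp
  \<comment> \<open>For \<open>y = 0\<close> this gives \<open>g = n\<close>, which represents the
    zero class.\<close>
  define g where "g = gcd y n"
  have g: "g > 0" using n by (simp add: g_def)
  have "coprime (y div g) (n div g)" unfolding g_def using n by (intro div_gcd_coprime) simp
  moreover have "n div g > 0" using n g by (simp add: g_def div_greater_zero_iff dvd_imp_le)
  ultimately obtain u where u: "u > 0" "[u = y div g] (mod n div g)"
    "\<And>p. prime p \<Longrightarrow> p dvd u \<Longrightarrow> p > n + (card S)\<^sup>2 * (card T)\<^sup>2"
    by (rule exists_cong_large_prime_factors[where B = "n + (card S)\<^sup>2 * (card T)\<^sup>2"]) blast
  \<comment> \<open>Multiplying by \<open>g\<close> lifts the congruence from modulus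
    \<open>n div g\<close> to \<open>n\<close>.\<close>
  have "[u * g = y] (mod n)"
  proof -
    have "(u * g) mod (n div g * g) = (y div g * g) mod (n div g * g)"
      using u(2) by (simp add: cong_def flip: mult_mod_left)
    thus ?thesis by (simp add: g_def cong_def)
  qed
  hence "[int y = int (u * g)] (mod int n)" using cong_sym cong_int_iff by blast
  hence "weight_enumerator n T (int y) = weight_enumerator n T (int (u * g))"
    by (rule weight_enumerator_cong)
  also have "\<dots> = weight_enumerator n T (int g)"
    using u(1) by (rule mult_invariant_of_prime_divisors[where w = "\<lambda>k. weight_enumerator n T (int k)"])
      (use u(3) weight_enumerator_mult_prime[OF dual n] in blast)
  also have "int g = gcd y' (int n)" by (simp add: g_def y')
  finally show "weight_enumerator n T y' = weight_enumerator n T (gcd y' (int n))" by (simp add: y')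
qed

end
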